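(* Let $(M_1,g_1,J_1)$ be a metallic Riemannian manifold with $J_1^2=pJ_1+qI$, where $p,q$ are positive integers, let $(\bar M,P,g)$ be a Golden Riemannian manifold, and let $F:M_1\to\bar M$ be a smooth map such that $F_*J_1=PF_*$. Let $\phi=\frac{1+\sqrt5}{2}$. If $p\neq q\phi+(1-\phi)$ and $p\neq q(1-\phi)+\phi$, then $F$ is a constant map.
   Context: All manifolds and maps are $C^\infty$; $F_*$ is the differential of $F$. A metallic Riemannian manifold $(M,g,J)$ is a Riemannian manifold $(M,g)$ with a $(1,1)$-tensor field $J$ such that $J^2=pJ+qI$ for some positive integers $p,q$ ($I$ the identity) and $g(JX,Y)=g(X,JY)$ for all vector fields $X,Y$; it is assumed throughout that $\nabla J=0$ for the Levi-Civita connection $\nabla$ of $g$. A Golden Riemannian manifold $(\bar M,P,g)$ is a Riemannian manifold $(\bar M,g)$ with a $(1,1)$-tensor field $P$ such that $P^2=P+I$ and $g(PX,Y)=g(X,PY)$ for all vector fields $X,Y$.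
   Formalization: The manifold M_1 is additionally assumed connected (otherwise F is only locally constant, e.g. two components sent to two different points); both manifolds have positive dimension. *)

theory Defs
  imports "HOL-Analysis.Analysis"
begin

text \<open>
  Manifolds are the types of class \<^class>\<open>t2_space\<close> and \<^class>\<open>second_countable_topology\<close> that
  carry a smooth atlas modelled on a Euclidean space (no boundary, constant dimension). The
  smooth structure is the one generated by the atlas, which need not be maximal.
\<close>

text \<open>Meant for open \<open>S\<close>.\<close>

fun Ck_on :: "nat \<Rightarrow> 'a::euclidean_space set \<Rightarrow> ('a \<Rightarrow> 'b::euclidean_space) \<Rightarrow> bool" where
  "Ck_on 0 S f \<longleftrightarrow> continuous_on S f"
| "Ck_on (Suc k) S f \<longleftrightarrow> (\<forall>x\<in>S. f differentiable (at x)) \<and>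
     (\<forall>v. Ck_on k S (\<lambda>x. frechet_derivative f (at x) v))"

definition smooth_on :: "'a::euclidean_space set \<Rightarrow> ('a \<Rightarrow> 'b::euclidean_space) \<Rightarrow> bool" where
  "smooth_on S f \<longleftrightarrow> (\<forall>k. Ck_on k S f)"

text \<open>A chart is a pair of its domain and its coordinate map, only the values of which on the
  domain matter.\<close>

type_synonym ('m, 'e) chart = "'m set \<times> ('m \<Rightarrow> 'e)"

definition smooth_atlas ::
  "('m::{t2_space,second_countable_topology}, 'e::euclidean_space) chart set \<Rightarrow> bool" where
  "smooth_atlas A \<longleftrightarrow>
     (\<forall>(U, x)\<in>A. open U \<and> open (x ` U) \<and> homeomorphism U (x ` U) x (inv_into U x)) \<and>
     (\<Union>(U, x)\<in>A. U) = UNIV \<and>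
     (\<forall>(U, x)\<in>A. \<forall>(V, y)\<in>A. smooth_on (x ` (U \<inter> V)) (y \<circ> inv_into U x))"

definition smooth_map ::
  "('m::topological_space, 'e::euclidean_space) chart set \<Rightarrow>
   ('n::topological_space, 'd::euclidean_space) chart set \<Rightarrow> ('m \<Rightarrow> 'n) \<Rightarrow> bool" where
  "smooth_map A B F \<longleftrightarrow> continuous_on UNIV F \<and>
     (\<forall>(U, x)\<in>A. \<forall>(V, y)\<in>B. smooth_on (x ` (U \<inter> F -` V)) (y \<circ> F \<circ> inv_into U x))"

definition smooth_functions ::
  "('m::topological_space, 'e::euclidean_space) chart set \<Rightarrow> ('m \<Rightarrow> real) set" where
  "smooth_functions A = {f. smooth_map A {(UNIV, id)} f}"

text \<open>Tangent vectors at a point are the derivations there of the algebra of smooth functions.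
  They are set to 0 on functions that are not smooth, so that equality of tangent vectors is
  equality of HOL functions.\<close>

type_synonym 'm tvec = "('m \<Rightarrow> real) \<Rightarrow> real"
type_synonym 'm vfield = "'m \<Rightarrow> 'm tvec"

definition tangent_space ::
  "('m::topological_space, 'e::euclidean_space) chart set \<Rightarrow> 'm \<Rightarrow> 'm tvec set" where
  "tangent_space A x = {X.
     (\<forall>f. f \<notin> smooth_functions A \<longrightarrow> X f = 0) \<and>
     (\<forall>f\<in>smooth_functions A. \<forall>h\<in>smooth_functions A. \<forall>a b.
        X (\<lambda>y. a * f y + b * h y) = a * X f + b * X h) \<and>
     (\<forall>f\<in>smooth_functions A. \<forall>h\<in>smooth_functions A.
        X (\<lambda>y. f y * h y) = f x * X h + h x * X f)}"

definition lincomb :: "real \<Rightarrow> 'm tvec \<Rightarrow> real \<Rightarrow> 'm tvec \<Rightarrow> 'm tvec" where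
  "lincomb a X b Y = (\<lambda>f. a * X f + b * Y f)"

definition differential ::
  "('n::topological_space, 'd::euclidean_space) chart set \<Rightarrow> ('m \<Rightarrow> 'n) \<Rightarrow> 'm tvec \<Rightarrow> 'n tvec" where
  "differential B F X = (\<lambda>h. if h \<in> smooth_functions B then X (h \<circ> F) else 0)"

definition vector_fields ::
  "('m::topological_space, 'e::euclidean_space) chart set \<Rightarrow> 'm vfield set" where
  "vector_fields A = {X. (\<forall>x. X x \<in> tangent_space A x) \<and>
     (\<forall>f\<in>smooth_functions A. (\<lambda>x. X x f) \<in> smooth_functions A)}"

definition lie_bracket :: "'m vfield \<Rightarrow> 'm vfield \<Rightarrow> 'm vfield" where
  "lie_bracket X Y = (\<lambda>x f. X x (\<lambda>y. Y y f) - Y x (\<lambda>y. X y f))"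

definition tensor_field_1_1 ::
  "('m::topological_space, 'e::euclidean_space) chart set \<Rightarrow>
   ('m \<Rightarrow> 'm tvec \<Rightarrow> 'm tvec) \<Rightarrow> bool" where
  "tensor_field_1_1 A J \<longleftrightarrow>
     (\<forall>x. \<forall>X\<in>tangent_space A x. J x X \<in> tangent_space A x) \<and>
     (\<forall>x. \<forall>X\<in>tangent_space A x. \<forall>Y\<in>tangent_space A x. \<forall>a b.
        J x (lincomb a X b Y) = lincomb a (J x X) b (J x Y)) \<and>
     (\<forall>X\<in>vector_fields A. (\<lambda>x. J x (X x)) \<in> vector_fields A)"

definition riemannian_metric ::
  "('m::topological_space, 'e::euclidean_space) chart set \<Rightarrow>
   ('m \<Rightarrow> 'm tvec \<Rightarrow> 'm tvec \<Rightarrow> real) \<Rightarrow> bool" where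
  "riemannian_metric A g \<longleftrightarrow>
     (\<forall>x. \<forall>X\<in>tangent_space A x. \<forall>Y\<in>tangent_space A x. g x X Y = g x Y X) \<and>
     (\<forall>x. \<forall>X\<in>tangent_space A x. \<forall>Y\<in>tangent_space A x. \<forall>Z\<in>tangent_space A x. \<forall>a b.
        g x (lincomb a X b Y) Z = a * g x X Z + b * g x Y Z) \<and>
     (\<forall>x. \<forall>X\<in>tangent_space A x. X \<noteq> (\<lambda>f. 0) \<longrightarrow> 0 < g x X X) \<and>
     (\<forall>X\<in>vector_fields A. \<forall>Y\<in>vector_fields A. (\<lambda>x. g x (X x) (Y x)) \<in> smooth_functions A)"

definition riemannian_manifold ::
  "('m::{t2_space,second_countable_topology}, 'e::euclidean_space) chart set \<Rightarrow>
   ('m \<Rightarrow> 'm tvec \<Rightarrow> 'm tvec \<Rightarrow> real) \<Rightarrow> bool" where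
  "riemannian_manifold A g \<longleftrightarrow> smooth_atlas A \<and> riemannian_metric A g"

definition affine_connection ::
  "('m::topological_space, 'e::euclidean_space) chart set \<Rightarrow>
   ('m vfield \<Rightarrow> 'm vfield \<Rightarrow> 'm vfield) \<Rightarrow> bool" where
  "affine_connection A D \<longleftrightarrow>
     (\<forall>X\<in>vector_fields A. \<forall>Y\<in>vector_fields A. D X Y \<in> vector_fields A) \<and>
     (\<forall>X\<in>vector_fields A. \<forall>Y\<in>vector_fields A. \<forall>Z\<in>vector_fields A.
        \<forall>f\<in>smooth_functions A. \<forall>h\<in>smooth_functions A.
          D (\<lambda>x. lincomb (f x) (X x) (h x) (Y x)) Z =
          (\<lambda>x. lincomb (f x) (D X Z x) (h x) (D Y Z x))) \<and>
     (\<forall>X\<in>vector_fields A. \<forall>Y\<in>vector_fields A. \<forall>Z\<in>vector_fields A. \<forall>a b.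
          D X (\<lambda>x. lincomb a (Y x) b (Z x)) = (\<lambda>x. lincomb a (D X Y x) b (D X Z x))) \<and>
     (\<forall>X\<in>vector_fields A. \<forall>Y\<in>vector_fields A. \<forall>f\<in>smooth_functions A.
          D X (\<lambda>x h. f x * Y x h) = (\<lambda>x. lincomb (X x f) (Y x) (f x) (D X Y x)))"

definition levi_civita ::
  "('m::topological_space, 'e::euclidean_space) chart set \<Rightarrow>
   ('m \<Rightarrow> 'm tvec \<Rightarrow> 'm tvec \<Rightarrow> real) \<Rightarrow> ('m vfield \<Rightarrow> 'm vfield \<Rightarrow> 'm vfield) \<Rightarrow> bool" where
  "levi_civita A g D \<longleftrightarrow> affine_connection A D \<and>
     (\<forall>X\<in>vector_fields A. \<forall>Y\<in>vector_fields A.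
        (\<lambda>x. lincomb 1 (D X Y x) (- 1) (D Y X x)) = lie_bracket X Y) \<and>
     (\<forall>X\<in>vector_fields A. \<forall>Y\<in>vector_fields A. \<forall>Z\<in>vector_fields A. \<forall>x.
        X x (\<lambda>y. g y (Y y) (Z y)) = g x (D X Y x) (Z x) + g x (Y x) (D X Z x))"

text \<open>The covariant derivative \<open>(D\<^sub>X J) Y = D\<^sub>X (J Y) - J (D\<^sub>X Y)\<close>.\<close>

definition covariant_derivative_1_1 ::
  "('m vfield \<Rightarrow> 'm vfield \<Rightarrow> 'm vfield) \<Rightarrow> ('m \<Rightarrow> 'm tvec \<Rightarrow> 'm tvec) \<Rightarrow>
   'm vfield \<Rightarrow> 'm vfield \<Rightarrow> 'm vfield" where
  "covariant_derivative_1_1 D J X Y =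
     (\<lambda>x. lincomb 1 (D X (\<lambda>y. J y (Y y)) x) (- 1) (J x (D X Y x)))"

definition self_adjoint ::
  "('m::topological_space, 'e::euclidean_space) chart set \<Rightarrow>
   ('m \<Rightarrow> 'm tvec \<Rightarrow> 'm tvec \<Rightarrow> real) \<Rightarrow> ('m \<Rightarrow> 'm tvec \<Rightarrow> 'm tvec) \<Rightarrow> bool" where
  "self_adjoint A g J \<longleftrightarrow> (\<forall>X\<in>vector_fields A. \<forall>Y\<in>vector_fields A. \<forall>x.
     g x (J x (X x)) (Y x) = g x (X x) (J x (Y x)))"

text \<open>The Levi-Civita connection exists and is unique, so quantifying it existentially is the
  same as referring to it.\<close>

definition metallic_riemannian_manifold ::
  "('m::{t2_space,second_countable_topology}, 'e::euclidean_space) chart set \<Rightarrow>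
   ('m \<Rightarrow> 'm tvec \<Rightarrow> 'm tvec \<Rightarrow> real) \<Rightarrow> ('m \<Rightarrow> 'm tvec \<Rightarrow> 'm tvec) \<Rightarrow> nat \<Rightarrow> nat \<Rightarrow> bool" where
  "metallic_riemannian_manifold A g J p q \<longleftrightarrow>
     riemannian_manifold A g \<and> tensor_field_1_1 A J \<and> 0 < p \<and> 0 < q \<and>
     (\<forall>x. \<forall>X\<in>tangent_space A x. J x (J x X) = lincomb (real p) (J x X) (real q) X) \<and>
     self_adjoint A g J \<and>
     (\<exists>D. levi_civita A g D \<and> (\<forall>X\<in>vector_fields A. \<forall>Y\<in>vector_fields A.
        covariant_derivative_1_1 D J X Y = (\<lambda>x f. 0)))"

definition golden_riemannian_manifold ::
  "('m::{t2_space,second_countable_topology}, 'e::euclidean_space) chart set \<Rightarrow>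
   ('m \<Rightarrow> 'm tvec \<Rightarrow> 'm tvec) \<Rightarrow> ('m \<Rightarrow> 'm tvec \<Rightarrow> 'm tvec \<Rightarrow> real) \<Rightarrow> bool" where
  "golden_riemannian_manifold A P g \<longleftrightarrow>
     riemannian_manifold A g \<and> tensor_field_1_1 A P \<and>
     (\<forall>x. \<forall>X\<in>tangent_space A x. P x (P x X) = lincomb 1 (P x X) 1 X) \<and>
     self_adjoint A g P"

end

theory Submission
  imports Defs
begin

text \<open>
  Put \<open>V = F\<^sub>* X\<close>. Computing \<open>F\<^sub>* (J\<^sub>1 (J\<^sub>1 X)) = P (P V)\<close> with either structure equation gives
  \<open>(p - 1) P V + (q - 1) V = 0\<close>. The two conditions on \<open>p\<close> and \<open>q\<close> amount to \<open>(p, q) \<noteq> (1, 1)\<close>, so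
  either \<open>V = 0\<close> at once, or \<open>V\<close> is an eigenvector of \<open>P\<close> with rational eigenvalue or zero; since
  \<open>c\<^sup>2 = c + 1\<close> has no rational solution, \<open>F\<^sub>* = 0\<close> in every case. Then \<open>h \<circ> F\<close> is locally constant,
  hence constant, for every smooth function \<open>h\<close> on the target, and bump functions separate points.
\<close>

section \<open>Closure properties of smooth maps\<close>

text \<open>At a point of the open set \<open>S\<close> a derivative sees only nearby values, so
  agreement on \<open>S\<close> passes to the derivatives and the induction applies to them.\<close>

lemma Ck_on_cong:
  assumes "open S" "Ck_on k S f" "\<And>x. x \<in> S \<Longrightarrow> f x = g x"
  shows "Ck_on k S g"
  using assms(2,3)
proof (induction k arbitrary: f g)
  case 0
  then show ?case using continuous_on_cong by (metis Ck_on.simps(1))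
next
  case (Suc k)
  have d: "(g has_derivative frechet_derivative f (at x)) (at x)" if "x \<in> S" for x
    using Suc.prems that assms(1) frechet_derivative_works
    by (metis Ck_on.simps(2) has_derivative_transform_within_open)
  have "Ck_on k S (\<lambda>x. frechet_derivative g (at x) v)" for v
  proof (rule Suc.IH)
    show "Ck_on k S (\<lambda>x. frechet_derivative f (at x) v)" using Suc.prems(1) by simp
    show "frechet_derivative f (at x) v = frechet_derivative g (at x) v" if "x \<in> S" for x
      using frechet_derivative_at[OF d[OF that]] by (rule fun_cong)
  qed
  with d show ?case unfolding Ck_on.simps(2) differentiable_def by blast
qed

text \<open>Lets the closure proofs work with an explicit derivative \<open>f'\<close> supplied by a
  differentiation rule; uniqueness of derivatives identifies it with
  \<open>frechet_derivative\<close>.\<close>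

lemma Ck_on_SucI:
  assumes "open S" "\<And>x. x \<in> S \<Longrightarrow> (f has_derivative f' x) (at x)"
    and "\<And>v. Ck_on k S (\<lambda>x. f' x v)"
  shows "Ck_on (Suc k) S f"
proof -
  have "f' x = frechet_derivative f (at x)" if "x \<in> S" for x
    using frechet_derivative_at assms(2) that by blast
  then have "Ck_on k S (\<lambda>x. frechet_derivative f (at x) v)" for v
    by (intro Ck_on_cong[OF assms(1) assms(3)[of v]]) simp
  then show ?thesis
    using assms(2) by (auto simp: differentiable_def)
qed

lemma Ck_on_has_derivative:
  "Ck_on (Suc k) S f \<Longrightarrow> x \<in> S \<Longrightarrow> (f has_derivative frechet_derivative f (at x)) (at x)"
  by (simp add: frechet_derivative_works)

lemma Ck_on_Suc_imp: "Ck_on (Suc k) S f \<Longrightarrow> Ck_on k S f"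
proof (induction k arbitrary: f)
  case 0
  then have "f differentiable_on S"
    by (simp add: differentiable_at_imp_differentiable_on)
  then show ?case by (simp add: differentiable_imp_continuous_on)
next
  case (Suc k)
  note prems = Suc.prems[unfolded Ck_on.simps(2)[of "Suc k"]]
  have "Ck_on k S (\<lambda>x. frechet_derivative f (at x) v)" for v
    by (rule Suc.IH) (use prems in blast)
  with prems show ?case unfolding Ck_on.simps(2)[of k] by blast
qed

text \<open>A neighbourhood that works for \<open>f\<close> also works for its directional
  derivatives. This later allows smoothness on a chart to be checked near each point.\<close>

lemma Ck_on_locally:
  assumes "\<And>x. x \<in> S \<Longrightarrow> \<exists>T. open T \<and> x \<in> T \<and> Ck_on k T f"
  shows "Ck_on k S f"
  using assms
proof (induction k arbitrary: f)
  case 0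
  then show ?case
    by (metis Ck_on.simps(1) continuous_at_imp_continuous_on continuous_on_eq_continuous_at)
next
  case (Suc k)
  show ?case unfolding Ck_on.simps(2)
  proof (intro conjI ballI allI)
    show "f differentiable at x" if "x \<in> S" for x
      using Suc.prems[OF that] by auto
    show "Ck_on k S (\<lambda>x. frechet_derivative f (at x) v)" for v
    proof (rule Suc.IH)
      fix x assume "x \<in> S"
      from Suc.prems[OF this] obtain T where "open T" "x \<in> T" "Ck_on (Suc k) T f" by blast
      then show "\<exists>T. open T \<and> x \<in> T \<and> Ck_on k T (\<lambda>x. frechet_derivative f (at x) v)"
        unfolding Ck_on.simps(2) by blast
    qed
  qed
qed

lemma Ck_on_const: "open S \<Longrightarrow> Ck_on k S (\<lambda>x. c)"
proof (induction k arbitrary: c)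
  case (Suc k)
  show ?case by (rule Ck_on_SucI[where f' = "\<lambda>x v. 0"]) (use Suc in auto)
qed simp

lemma Ck_on_bounded_linear:
  assumes "bounded_linear L" "open S" "Ck_on k S f"
  shows "Ck_on k S (\<lambda>x. L (f x))"
  using assms(3)
proof (induction k arbitrary: f)
  case 0
  then show ?case using assms(1) bounded_linear.continuous_on by auto
next
  case (Suc k)
  show ?case
    by (rule Ck_on_SucI[OF assms(2) bounded_linear.has_derivative[OF assms(1)
          Ck_on_has_derivative[OF Suc.prems]]]) (use Suc in auto)
qed

lemma Ck_on_add:
  assumes "open S" "Ck_on k S f" "Ck_on k S g"
  shows "Ck_on k S (\<lambda>x. f x + g x)"
  using assms(2,3)
proof (induction k arbitrary: f g)
  case 0
  then show ?case by (simp add: continuous_on_add)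
next
  case (Suc k)
  show ?case
    by (rule Ck_on_SucI[OF assms(1) has_derivative_add[OF
          Ck_on_has_derivative[OF Suc.prems(1)] Ck_on_has_derivative[OF Suc.prems(2)]]])
      (use Suc in auto)
qed

lemma Ck_on_sum:
  assumes "open S" "finite B" "\<And>b. b \<in> B \<Longrightarrow> Ck_on k S (f b)"
  shows "Ck_on k S (\<lambda>x. \<Sum>b\<in>B. f b x)"
  using assms(2,3)
  by (induction B rule: finite_induct) (auto intro: Ck_on_const Ck_on_add assms(1))

lemma Ck_on_bounded_bilinear:
  assumes "bounded_bilinear m" "open S" "Ck_on k S f" "Ck_on k S g"
  shows "Ck_on k S (\<lambda>x. m (f x) (g x))"
  using assms(3,4)
proof (induction k arbitrary: f g)
  case 0
  then show ?case using bounded_bilinear.continuous_on[OF assms(1)] by auto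
next
  case (Suc k)
  \<comment> \<open>The product rule leaves one factor undifferentiated in each summand, so the
    induction hypothesis also needs \<open>f\<close> and \<open>g\<close> themselves at the lower
    order.\<close>
  have "Ck_on k S f" "Ck_on k S g"
    using Suc.prems Ck_on_Suc_imp by blast+
  then show ?case
    by (intro Ck_on_SucI[OF assms(2) bounded_bilinear.FDERIV[OF assms(1)
          Ck_on_has_derivative[OF Suc.prems(1)] Ck_on_has_derivative[OF Suc.prems(2)]]]
        Ck_on_add assms(2) Suc.IH) (use Suc.prems in auto)
qed

text \<open>By the chain rule the derivative is built from directional derivatives of
  \<open>g\<close> composed with the same \<open>f\<close>. Hence the induction varies
  \<open>g\<close> and keeps \<open>f\<close> fixed.\<close>

lemma Ck_on_compose:
  assumes "open S" "open T" "Ck_on k S f" "Ck_on k T g" "f ` S \<subseteq> T"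
  shows "Ck_on k S (g \<circ> f)"
  using assms(3,4)
proof (induction k arbitrary: g)
  case 0
  then show ?case
    using assms(5) continuous_on_compose[of S f g] continuous_on_subset[of T g "f ` S"] by simp
next
  case (Suc k)
  let ?df = "\<lambda>x v. frechet_derivative f (at x) v"
  let ?dg = "\<lambda>x v. frechet_derivative g (at (f x)) v"
  have der: "(g has_derivative ?dg x) (at (f x))" if "x \<in> S" for x
    using that assms(5) by (intro Ck_on_has_derivative[OF Suc.prems(2)]) auto
  show ?case
  proof (rule Ck_on_SucI[OF assms(1)])
    fix x assume x: "x \<in> S"
    have "(g \<circ> f has_derivative ?dg x \<circ> ?df x) (at x)"
      by (rule diff_chain_at[OF Ck_on_has_derivative[OF Suc.prems(1) x] der[OF x]])
    \<comment> \<open>\<open>Ck_on\<close> controls the derivative of \<open>g\<close> only along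
      fixed directions, whereas \<open>?df x v\<close> moves with \<open>x\<close>. Expanding it in
      the basis leaves fixed directions \<open>b\<close> with scalar coefficients depending on
      \<open>x\<close>.\<close>
    moreover have "?dg x \<circ> ?df x = (\<lambda>v. \<Sum>b\<in>Basis. (?df x v \<bullet> b) *\<^sub>R ?dg x b)"
    proof
      fix v
      have "?dg x (?df x v) = ?dg x (\<Sum>b\<in>Basis. (?df x v \<bullet> b) *\<^sub>R b)"
        by (simp add: euclidean_representation)
      also have "\<dots> = (\<Sum>b\<in>Basis. (?df x v \<bullet> b) *\<^sub>R ?dg x b)"
        using has_derivative_linear[OF der[OF x]] by (simp add: linear_sum linear_cmul)
      finally show "(?dg x \<circ> ?df x) v = (\<Sum>b\<in>Basis. (?df x v \<bullet> b) *\<^sub>R ?dg x b)" by simp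
    qed
    ultimately show "(g \<circ> f has_derivative (\<lambda>v. \<Sum>b\<in>Basis. (?df x v \<bullet> b) *\<^sub>R ?dg x b)) (at x)"
      by simp
  next
    fix v
    have "Ck_on k S (\<lambda>x. ?dg x b)" for b
    proof -
      have "Ck_on k T (\<lambda>y. frechet_derivative g (at y) b)" using Suc.prems(2) by simp
      from Suc.IH[OF Ck_on_Suc_imp[OF Suc.prems(1)] this] show ?thesis by (simp only: o_def)
    qed
    moreover have "Ck_on k S (\<lambda>x. ?df x v)" using Suc.prems(1) by simp
    then have "Ck_on k S (\<lambda>x. ?df x v \<bullet> b)" for b
      by (rule Ck_on_bounded_linear[OF bounded_linear_inner_left assms(1)])
    ultimately show "Ck_on k S (\<lambda>x. \<Sum>b\<in>Basis. (?df x v \<bullet> b) *\<^sub>R ?dg x b)"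
      by (intro Ck_on_sum[OF assms(1) finite_Basis]
          Ck_on_bounded_bilinear[OF bounded_bilinear_scaleR assms(1)])
  qed
qed

lemma Ck_on_id: "open S \<Longrightarrow> Ck_on k S (\<lambda>x. x)"
proof (cases k)
  case (Suc l)
  assume "open S"
  then show ?thesis unfolding Suc
    by (intro Ck_on_SucI[where f' = "\<lambda>x v. v"]) (auto intro: Ck_on_const)
qed simp

section \<open>From finite order of differentiability to smoothness\<close>

lemma smooth_on_cong:
  "open S \<Longrightarrow> smooth_on S f \<Longrightarrow> (\<And>x. x \<in> S \<Longrightarrow> f x = g x) \<Longrightarrow> smooth_on S g"
  unfolding smooth_on_def using Ck_on_cong by blast

lemma smooth_on_locally:
  "(\<And>x. x \<in> S \<Longrightarrow> \<exists>T. open T \<and> x \<in> T \<and> smooth_on T f) \<Longrightarrow> smooth_on S f"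
  unfolding smooth_on_def by (meson Ck_on_locally)

lemma smooth_on_compose:
  "open S \<Longrightarrow> open T \<Longrightarrow> smooth_on S f \<Longrightarrow> smooth_on T g \<Longrightarrow> f ` S \<subseteq> T \<Longrightarrow> smooth_on S (g \<circ> f)"
  unfolding smooth_on_def using Ck_on_compose by blast

lemma smooth_on_has_derivative:
  "smooth_on S f \<Longrightarrow> x \<in> S \<Longrightarrow> (f has_derivative frechet_derivative f (at x)) (at x)"
  unfolding smooth_on_def using Ck_on_has_derivative by blast

section \<open>Bump functions\<close>

text \<open>The functions \<open>t\<^sup>-\<^sup>n exp (-1/t)\<close>, extended by 0, form a family whose span is closed under
  differentiation, so that the smoothness of all of them follows by one induction.\<close>

definition flat_exp :: "nat \<Rightarrow> real \<Rightarrow> real" where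
  "flat_exp n t = (if 0 < t then inverse t ^ n * exp (- inverse t) else 0)"

lemma flat_exp_tendsto_0: "(flat_exp n \<longlongrightarrow> 0) (at 0)"
proof (rule filterlim_split_at)
  show "(flat_exp n \<longlongrightarrow> 0) (at_left 0)"
    by (rule tendsto_eventually)
      (auto simp: flat_exp_def eventually_at_filter intro: always_eventually)
  \<comment> \<open>Substituting \<open>s = inverse t\<close> turns this into the decay of
    \<open>s ^ n / exp s\<close> at infinity.\<close>
  have "((\<lambda>t. inverse t ^ n / exp (inverse t)) \<longlongrightarrow> (0::real)) (at_right 0)"
    using filterlim_compose[OF tendsto_power_div_exp_0 filterlim_inverse_at_top_right] .
  then show "(flat_exp n \<longlongrightarrow> 0) (at_right 0)"
    by (rule Lim_transform_eventually)
      (auto simp: flat_exp_def eventually_at_filter exp_minus divide_inverse)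
qed

lemma flat_exp_has_real_derivative:
  "(flat_exp n has_real_derivative flat_exp (n + 2) t - n * flat_exp (n + 1) t) (at t)"
proof -
  consider "t < 0" | "t = 0" | "0 < t" by linarith
  then show ?thesis
  proof cases
    case 1
    then show ?thesis
      using has_field_derivative_transform_within_open[of "\<lambda>_. 0" 0 t "{..<0}" "flat_exp n"]
      by (auto simp: flat_exp_def)
  next
    case 2
    \<comment> \<open>The difference quotient at 0 is the next member of the family, so its limit is
      already known. At \<open>h = 0\<close> both sides are 0, the left one by the convention for
      division by zero.\<close>
    have quot: "(\<lambda>h. (flat_exp n (0 + h) - flat_exp n 0) / h) = flat_exp (n + 1)"
      by (auto simp: flat_exp_def divide_inverse)
    show ?thesis
      unfolding DERIV_def 2 quot using flat_exp_tendsto_0[of "n + 1"]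
      by (simp add: flat_exp_def[of _ 0])
  next
    case 3
    have inv: "(inverse has_real_derivative - (inverse t ^ 2)) (at t)"
      using DERIV_inverse[of t] 3 by (simp add: power2_eq_square)
    have "((\<lambda>t. inverse t ^ n * exp (- inverse t)) has_real_derivative
        flat_exp (n + 2) t - n * flat_exp (n + 1) t) (at t)"
      by (rule DERIV_cong[OF DERIV_mult[OF DERIV_power[OF inv] DERIV_fun_exp[OF DERIV_minus[OF inv]]]])
        (use 3 in \<open>cases n; simp add: flat_exp_def power2_eq_square algebra_simps\<close>)
    then show ?thesis
      by (rule has_field_derivative_transform_within_open[where S = "{0<..}"]) (use 3 in \<open>auto simp: flat_exp_def\<close>)
  qed
qed

lemma Ck_on_flat_exp: "Ck_on k UNIV (flat_exp n)"
proof (induction k arbitrary: n)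
  case 0
  show ?case
    using DERIV_isCont[OF flat_exp_has_real_derivative[of n]]
    by (simp add: continuous_at_imp_continuous_on)
next
  case (Suc k)
  have "bounded_linear (\<lambda>y::real. y * v)" "bounded_linear (\<lambda>y::real. - (n * y))" for v n
    by (intro bounded_linear_minus bounded_linear_mult_left bounded_linear_mult_right)+
  note lin = Ck_on_bounded_linear[OF this(1)] Ck_on_bounded_linear[OF this(2)]
  have "Ck_on k UNIV (\<lambda>t. (flat_exp (n + 2) t + - (n * flat_exp (n + 1) t)) * v)" for v
    by (rule lin(1)[OF open_UNIV Ck_on_add[OF open_UNIV Suc lin(2)[OF open_UNIV Suc]]])
  then show ?case
    by (intro Ck_on_SucI[OF open_UNIV has_field_derivative_imp_has_derivative[OF
          flat_exp_has_real_derivative]]) simp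
qed

text \<open>The squared distance is smooth everywhere, including at \<open>c\<close>, where the norm
  is not. For \<open>0 < r\<close> the function is positive exactly on the open ball of radius
  \<open>r\<close> about \<open>c\<close>.\<close>

definition bump :: "'a::euclidean_space \<Rightarrow> real \<Rightarrow> 'a \<Rightarrow> real" where
  "bump c r z = flat_exp 0 (r\<^sup>2 - (z - c) \<bullet> (z - c))"

lemma smooth_on_bump: "smooth_on UNIV (bump c r)"
  unfolding smooth_on_def
proof
  fix k
  have "Ck_on k UNIV (\<lambda>z. z + (- c))"
    by (intro Ck_on_add Ck_on_id Ck_on_const open_UNIV)
  then have "Ck_on k UNIV (\<lambda>z. (z + (- c)) \<bullet> (z + (- c)))"
    using Ck_on_bounded_bilinear[OF bounded_bilinear_inner open_UNIV] by blast
  then have "Ck_on k UNIV (\<lambda>z. - ((z + (- c)) \<bullet> (z + (- c))))"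
    using Ck_on_bounded_linear[OF bounded_linear_minus[OF bounded_linear_ident] open_UNIV] by blast
  then have "Ck_on k UNIV (\<lambda>z. r\<^sup>2 + - ((z + (- c)) \<bullet> (z + (- c))))"
    by (intro Ck_on_add Ck_on_const open_UNIV)
  from Ck_on_compose[OF open_UNIV open_UNIV this Ck_on_flat_exp[of k 0]]
  show "Ck_on k UNIV (bump c r)"
    by (simp add: o_def bump_def[abs_def])
qed

lemma bump_center_pos: "0 < r \<Longrightarrow> 0 < bump c r c"
  by (simp add: bump_def flat_exp_def)

lemma bump_eq_0: "0 < r \<Longrightarrow> r \<le> dist c z \<Longrightarrow> bump c r z = 0"
  by (auto simp: bump_def flat_exp_def dist_norm norm_minus_commute not_less
      simp flip: power2_norm_eq_inner)

section \<open>Smooth functions on manifolds\<close>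

lemma smooth_atlasD:
  assumes "smooth_atlas A" "(U, x) \<in> A"
  shows "open U" "open (x ` U)" "homeomorphism U (x ` U) x (inv_into U x)"
  using assms unfolding smooth_atlas_def by blast+

lemma smooth_atlas_cover: "smooth_atlas A \<Longrightarrow> \<exists>U x. (U, x) \<in> A \<and> p \<in> U"
  unfolding smooth_atlas_def by blast

lemma chart_inv:
  assumes "smooth_atlas A" "(U, x) \<in> A"
  shows "p \<in> U \<Longrightarrow> inv_into U x (x p) = p"
    and "z \<in> x ` U \<Longrightarrow> inv_into U x z \<in> U"
    and "z \<in> x ` U \<Longrightarrow> x (inv_into U x z) = z"
  using smooth_atlasD(3)[OF assms] unfolding homeomorphism_def by (auto simp: inv_into_into f_inv_into_f)

lemma open_chart_image:
  assumes "smooth_atlas A" "(U, x) \<in> A" "open W" "W \<subseteq> U"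
  shows "open (x ` W)"
proof -
  have "openin (top_of_set (x ` U)) (x ` W)"
    using smooth_atlasD[OF assms(1,2)] assms(3,4)
    by (intro homeomorphism_imp_open_map) (auto simp: openin_open_eq)
  then show ?thesis
    using smooth_atlasD(2)[OF assms(1,2)] by (simp add: openin_open_eq)
qed

lemma smooth_functions_iff:
  "f \<in> smooth_functions A \<longleftrightarrow> continuous_on UNIV f \<and>
     (\<forall>(U, x)\<in>A. smooth_on (x ` U) (f \<circ> inv_into U x))"
  by (auto simp: smooth_functions_def smooth_map_def)

text \<open>Meant for functions given by different formulas on different parts of a chart domain:
  near each point a smaller \<open>W\<close> with a single formula suffices.\<close>

lemma smooth_functionsI:
  assumes A: "smooth_atlas A"
    and cont: "continuous_on UNIV f"
    and loc: "\<And>U x p. (U, x) \<in> A \<Longrightarrow> p \<in> U \<Longrightarrow>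
      \<exists>W. open W \<and> p \<in> W \<and> W \<subseteq> U \<and> smooth_on (x ` W) (f \<circ> inv_into U x)"
  shows "f \<in> smooth_functions A"
  unfolding smooth_functions_iff
proof (intro conjI cont ballI, clarify)
  fix U x assume Ux: "(U, x) \<in> A"
  show "smooth_on (x ` U) (f \<circ> inv_into U x)"
  proof (rule smooth_on_locally)
    fix z assume "z \<in> x ` U"
    then obtain p where "p \<in> U" "z = x p" by blast
    then show "\<exists>T. open T \<and> z \<in> T \<and> smooth_on T (f \<circ> inv_into U x)"
      using loc[OF Ux] open_chart_image[OF A Ux] by blast
  qed
qed

lemma smooth_functions_Ck_on:
  "f \<in> smooth_functions A \<Longrightarrow> (U, x) \<in> A \<Longrightarrow> Ck_on k (x ` U) (f \<circ> inv_into U x)"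
  unfolding smooth_functions_iff smooth_on_def by blast

lemma smooth_functions_lincomb:
  assumes A: "smooth_atlas A" and "f \<in> smooth_functions A" "h \<in> smooth_functions A"
  shows "(\<lambda>y. a * f y + b * h y) \<in> smooth_functions A"
  unfolding smooth_functions_iff
proof (intro conjI ballI, goal_cases)
  case 1
  have "continuous_on UNIV f" "continuous_on UNIV h"
    using assms by (simp_all add: smooth_functions_iff)
  then show ?case by (intro continuous_on_add continuous_on_mult_left)
next
  case (2 chart)
  obtain U x where chart: "chart = (U, x)" by (cases chart)
  with 2 have c: "(U, x) \<in> A" by simp
  note opn = smooth_atlasD(2)[OF A c]
  have "Ck_on k (x ` U) (\<lambda>z. a * (f \<circ> inv_into U x) z + b * (h \<circ> inv_into U x) z)" for k
    by (rule Ck_on_add[OF opn Ck_on_bounded_linear[OF bounded_linear_mult_right opn]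
          Ck_on_bounded_linear[OF bounded_linear_mult_right opn]])
      (rule smooth_functions_Ck_on[OF assms(2) c] smooth_functions_Ck_on[OF assms(3) c])+
  then show ?case by (simp add: chart smooth_on_def o_def)
qed

lemma smooth_functions_mult:
  assumes A: "smooth_atlas A" and "f \<in> smooth_functions A" "h \<in> smooth_functions A"
  shows "(\<lambda>y. f y * h y) \<in> smooth_functions A"
  unfolding smooth_functions_iff
proof (intro conjI ballI, goal_cases)
  case 1
  have "continuous_on UNIV f" "continuous_on UNIV h"
    using assms by (simp_all add: smooth_functions_iff)
  then show ?case by (rule continuous_on_mult)
next
  case (2 chart)
  obtain U x where chart: "chart = (U, x)" by (cases chart)
  with 2 have c: "(U, x) \<in> A" by simp
  note opn = smooth_atlasD(2)[OF A c]
  have "Ck_on k (x ` U) (\<lambda>z. (f \<circ> inv_into U x) z * (h \<circ> inv_into U x) z)" for k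
    by (rule Ck_on_bounded_bilinear[OF bounded_bilinear_mult opn
          smooth_functions_Ck_on[OF assms(2) c] smooth_functions_Ck_on[OF assms(3) c]])
  then show ?case by (simp add: chart smooth_on_def o_def)
qed

text \<open>Near a point, a chart \<open>(V, y)\<close> around its image factors the coordinate
  expression of \<open>h o F\<close> through that of \<open>F\<close> followed by that of
  \<open>h\<close>. Continuity of \<open>F\<close> makes the set where this is possible
  open.\<close>

lemma smooth_functions_compose:
  assumes A: "smooth_atlas A" and B: "smooth_atlas B"
    and F: "smooth_map A B F" and h: "h \<in> smooth_functions B"
  shows "h \<circ> F \<in> smooth_functions A"
proof (rule smooth_functionsI[OF A])
  have contF: "continuous_on UNIV F" using F by (simp add: smooth_map_def)
  show "continuous_on UNIV (h \<circ> F)"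
    using h contF continuous_on_compose2[of UNIV h UNIV F] by (simp add: smooth_functions_iff o_def)
  fix U x p assume Ux: "(U, x) \<in> A" and p: "p \<in> U"
  obtain V y where Vy: "(V, y) \<in> B" "F p \<in> V" using smooth_atlas_cover[OF B] by blast
  let ?W = "U \<inter> F -` V"
  have W: "open ?W"
    using open_vimage[OF smooth_atlasD(1)[OF B Vy(1)] contF] smooth_atlasD(1)[OF A Ux] by auto
  have inv: "inv_into U x z \<in> ?W" if "z \<in> x ` ?W" for z
    using that chart_inv(1)[OF A Ux] by auto
  have oW: "open (x ` ?W)" by (rule open_chart_image[OF A Ux W]) auto
  have "smooth_on (x ` ?W) ((h \<circ> inv_into V y) \<circ> (y \<circ> F \<circ> inv_into U x))"
  proof (rule smooth_on_compose[OF oW smooth_atlasD(2)[OF B Vy(1)]])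
    show "smooth_on (x ` ?W) (y \<circ> F \<circ> inv_into U x)"
      using F Ux Vy(1) unfolding smooth_map_def by blast
    show "smooth_on (y ` V) (h \<circ> inv_into V y)"
      using h Vy(1) unfolding smooth_functions_iff by blast
    show "(y \<circ> F \<circ> inv_into U x) ` (x ` ?W) \<subseteq> y ` V"
      using inv by auto
  qed
  then have "smooth_on (x ` ?W) (h \<circ> F \<circ> inv_into U x)"
    by (rule smooth_on_cong[OF oW]) (use inv chart_inv(1)[OF B Vy(1)] in auto)
  then show "\<exists>W. open W \<and> p \<in> W \<and> W \<subseteq> U \<and> smooth_on (x ` W) (h \<circ> F \<circ> inv_into U x)"
    using W p Vy(2) by blast
qed

text \<open>A bump around \<open>u\<close> in one chart, extended by 0, is positive at
  \<open>u\<close> and 0 at \<open>w\<close>. The extension is smooth because it vanishes off the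
  set \<open>K\<close>, which is closed in the whole manifold, so that \<open>V\<close> and the
  complement of \<open>K\<close> form an open cover.\<close>

lemma smooth_functions_separate:
  fixes B :: "('n::{t2_space,second_countable_topology}, 'd::euclidean_space) chart set"
  assumes B: "smooth_atlas B" and "u \<noteq> w"
  shows "\<exists>h\<in>smooth_functions B. h u \<noteq> h w"
proof -
  obtain V y where Vy: "(V, y) \<in> B" and u: "u \<in> V" using smooth_atlas_cover[OF B] by blast
  note chart = smooth_atlasD[OF B Vy] and inv = chart_inv[OF B Vy]
  obtain r0 where r0: "0 < r0" "cball (y u) r0 \<subseteq> y ` V"
    using chart(2) u open_contains_cball by (metis imageI)
  \<comment> \<open>Half the distance between the coordinates keeps \<open>y w\<close> out of the
    closed ball; for \<open>w\<close> outside \<open>V\<close> the extension by 0 already gives the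
    value 0.\<close>
  obtain r where r: "0 < r" "cball (y u) r \<subseteq> y ` V" "w \<in> V \<Longrightarrow> y w \<notin> cball (y u) r"
  proof (cases "w \<in> V")
    case True
    then have "y u \<noteq> y w" using inv(1) u \<open>u \<noteq> w\<close> by metis
    then have "0 < dist (y u) (y w)" by simp
    then show ?thesis
      using r0 by (intro that[of "min r0 (dist (y u) (y w) / 2)"]) auto
  next
    case False
    then show ?thesis using that r0 by blast
  qed
  define K where "K = inv_into V y ` cball (y u) r"
  have "compact K"
    unfolding K_def using chart(3) r(2)
    by (intro compact_continuous_image) (auto simp: homeomorphism_def intro: continuous_on_subset)
  \<comment> \<open>This is where the Hausdorff property enters: closedness inside the chart domain
    alone would not give closedness in the manifold.\<close>
  then have K: "open (- K)" using compact_imp_closed by blast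
  define h where "h q = (if q \<in> V then bump (y u) r (y q) else 0)" for q
  have hK: "h q = 0" if "q \<notin> K" for q
  proof (cases "q \<in> V")
    case True
    then have "y q \<notin> cball (y u) r" using that inv(1) unfolding K_def by (metis imageI)
    then show ?thesis using bump_eq_0[OF r(1), of "y u" "y q"] by (simp add: h_def)
  qed (simp add: h_def)
  have KV: "V \<union> - K = UNIV" using r(2) inv(2) by (auto simp: K_def)
  have "h \<in> smooth_functions B"
  proof (rule smooth_functionsI[OF B])
    have "Ck_on 0 UNIV (bump (y u) r)"
      using smooth_on_bump unfolding smooth_on_def by blast
    then have "continuous_on V (\<lambda>q. bump (y u) r (y q))"
      using chart(3) continuous_on_compose2[of UNIV "bump (y u) r" V y]
      by (auto simp: homeomorphism_def)
    then have "continuous_on V h" by (rule continuous_on_eq) (simp add: h_def)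
    moreover have "continuous_on (- K) h"
      by (rule continuous_on_eq[of _ "\<lambda>_. 0"]) (auto simp: hK)
    ultimately show "continuous_on UNIV h"
      using continuous_on_open_Un[OF chart(1) K] KV by metis
    fix U x p assume Ux: "(U, x) \<in> B" and p: "p \<in> U"
    note opens = open_chart_image[OF B Ux]
    show "\<exists>W. open W \<and> p \<in> W \<and> W \<subseteq> U \<and> smooth_on (x ` W) (h \<circ> inv_into U x)"
    proof (cases "p \<in> V")
      case True
      have o: "open (U \<inter> V)" using chart(1) smooth_atlasD(1)[OF B Ux] by auto
      have "smooth_on (x ` (U \<inter> V)) (y \<circ> inv_into U x)"
        using B Ux Vy unfolding smooth_atlas_def by blast
      then have "smooth_on (x ` (U \<inter> V)) (bump (y u) r \<circ> (y \<circ> inv_into U x))"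
        using smooth_on_compose[OF opens[OF o] open_UNIV _ smooth_on_bump] by blast
      then have "smooth_on (x ` (U \<inter> V)) (h \<circ> inv_into U x)"
        by (rule smooth_on_cong[rotated]) (use opens[OF o] chart_inv(1)[OF B Ux] in \<open>auto simp: h_def\<close>)
      then show ?thesis using True p o by blast
    next
      case False
      have o: "open (U - K)" using K smooth_atlasD(1)[OF B Ux] by (simp add: Diff_eq open_Int)
      have "smooth_on (x ` (U - K)) (\<lambda>_. 0 :: real)"
        unfolding smooth_on_def using opens[OF o] Ck_on_const by blast
      then have "smooth_on (x ` (U - K)) (h \<circ> inv_into U x)"
        by (rule smooth_on_cong[rotated]) (use opens[OF o] chart_inv(1)[OF B Ux] in \<open>auto simp: hK\<close>)
      then show ?thesis using False p o KV by blast
    qed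
  qed
  moreover have "h u > 0" using u bump_center_pos[OF r(1)] by (simp add: h_def)
  moreover have "h w = 0"
    using r(3) bump_eq_0[OF r(1), of "y u" "y w"] by (auto simp: h_def)
  ultimately show ?thesis by (intro bexI[of _ h]) auto
qed

section \<open>Differentials\<close>

lemma differential_in_tangent_space:
  assumes A: "smooth_atlas A" and B: "smooth_atlas B"
    and F: "smooth_map A B F" and X: "X \<in> tangent_space A p"
  shows "differential B F X \<in> tangent_space B (F p)"
  unfolding tangent_space_def
proof (intro CollectI conjI ballI allI impI)
  fix f h a b assume fh: "f \<in> smooth_functions B" "h \<in> smooth_functions B"
  note comp = smooth_functions_compose[OF A B F fh(1)] smooth_functions_compose[OF A B F fh(2)]
  show "differential B F X (\<lambda>y. a * f y + b * h y) = a * differential B F X f + b * differential B F X h"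
    using X comp smooth_functions_lincomb[OF B fh] fh
    by (simp add: differential_def tangent_space_def o_def)
  show "differential B F X (\<lambda>y. f y * h y) = f (F p) * differential B F X h + h (F p) * differential B F X f"
    using X comp smooth_functions_mult[OF B fh] fh
    by (simp add: differential_def tangent_space_def o_def)
qed (simp add: differential_def)

text \<open>The directional derivative along \<open>v\<close> in the coordinates of the chart. The
  value 0 off the smooth functions is what \<open>tangent_space\<close> demands. These derivations
  are enough to detect that all partial derivatives of a function vanish.\<close>

definition chart_vector ::
  "('m::topological_space, 'e::euclidean_space) chart set \<Rightarrow> 'm set \<Rightarrow> ('m \<Rightarrow> 'e) \<Rightarrow> 'm \<Rightarrow> 'e \<Rightarrow> 'm tvec" where
  "chart_vector A U x p v =
     (\<lambda>f. if f \<in> smooth_functions A then frechet_derivative (f \<circ> inv_into U x) (at (x p)) v else 0)"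

lemma chart_has_derivative:
  assumes "(U, x) \<in> A" "p \<in> U" "f \<in> smooth_functions A"
  shows "(f \<circ> inv_into U x has_derivative (\<lambda>v. chart_vector A U x p v f)) (at (x p))"
proof -
  have "smooth_on (x ` U) (f \<circ> inv_into U x)"
    using assms unfolding smooth_functions_iff by blast
  then show ?thesis
    using smooth_on_has_derivative assms by (fastforce simp: chart_vector_def)
qed

lemma chart_vector_in_tangent_space:
  assumes A: "smooth_atlas A" and Ux: "(U, x) \<in> A" and p: "p \<in> U"
  shows "chart_vector A U x p v \<in> tangent_space A p"
  unfolding tangent_space_def
proof (intro CollectI conjI ballI allI impI)
  fix f h a b assume fh: "f \<in> smooth_functions A" "h \<in> smooth_functions A"
  let ?X = "\<lambda>f v. chart_vector A U x p v f"
  note d = chart_has_derivative[OF Ux p]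
  note lc = smooth_functions_lincomb[OF A fh, of a b] and mu = smooth_functions_mult[OF A fh]
  have "((\<lambda>y. a * f y + b * h y) \<circ> inv_into U x has_derivative (\<lambda>v. a * ?X f v + b * ?X h v)) (at (x p))"
    using has_derivative_add[OF has_derivative_mult_right[OF d[OF fh(1)], of a]
        has_derivative_mult_right[OF d[OF fh(2)], of b]] by (simp add: o_def)
  from has_derivative_unique[OF d[OF lc] this]
  show "?X (\<lambda>y. a * f y + b * h y) v = a * ?X f v + b * ?X h v" by meson
  have "((\<lambda>y. f y * h y) \<circ> inv_into U x has_derivative (\<lambda>v. f p * ?X h v + ?X f v * h p)) (at (x p))"
    using has_derivative_mult[OF d[OF fh(1)] d[OF fh(2)]] chart_inv(1)[OF A Ux p]
    by (simp add: o_def)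
  from has_derivative_unique[OF d[OF mu] this]
  show "?X (\<lambda>y. f y * h y) v = f p * ?X h v + h p * ?X f v" by (metis mult.commute)
qed (simp add: chart_vector_def)

text \<open>Applied to the coordinate vectors, the hypothesis makes the derivative of
  \<open>f\<close> in any chart zero, so \<open>f\<close> is locally constant, and connectedness
  does the rest.\<close>

lemma smooth_function_constant_on:
  fixes A :: "('m::{t2_space,second_countable_topology}, 'e::euclidean_space) chart set"
  assumes A: "smooth_atlas A" and "connected (UNIV :: 'm set)"
    and f: "f \<in> smooth_functions A"
    and zero: "\<And>p X. X \<in> tangent_space A p \<Longrightarrow> X f = 0"
  shows "f constant_on UNIV"
proof (rule locally_constant_imp_constant[OF assms(2)])
  fix a :: 'm
  obtain U x where Ux: "(U, x) \<in> A" "a \<in> U" using smooth_atlas_cover[OF A] by blast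
  note chart = smooth_atlasD[OF A Ux(1)] and inv = chart_inv[OF A Ux(1)]
  obtain r where r: "0 < r" "ball (x a) r \<subseteq> x ` U"
    using chart(2) Ux(2) open_contains_ball by (metis imageI)
  have d: "(f \<circ> inv_into U x has_derivative (\<lambda>v. 0)) (at z)" if "z \<in> ball (x a) r" for z
  proof -
    from that r(2) have "z \<in> x ` U" by blast
    then obtain p where p: "p \<in> U" "z = x p" by blast
    show ?thesis
      using chart_has_derivative[OF Ux(1) p(1) f] p
        zero[OF chart_vector_in_tangent_space[OF A Ux(1) p(1)]] by simp
  qed
  let ?T = "U \<inter> x -` ball (x a) r"
  have opn: "open ?T"
    using continuous_open_preimage[OF _ chart(1) open_ball, of x] chart(3) by (simp add: homeomorphism_def)
  have const: "f b = f a" if "b \<in> ?T" for b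
  proof -
    have "(f \<circ> inv_into U x) (x b) = (f \<circ> inv_into U x) (x a)"
      by (rule has_derivative_zero_unique[OF convex_ball[of "x a" r] has_derivative_at_withinI[OF d]])
        (use that r(1) in simp_all)
    then show ?thesis using that inv(1) Ux(2) by simp
  qed
  show "\<exists>T. openin (top_of_set UNIV) T \<and> a \<in> T \<and> (\<forall>b\<in>T. f b = f a)"
  proof (intro exI conjI ballI)
    show "openin (top_of_set UNIV) ?T" using opn by (simp only: subtopology_UNIV open_openin)
    show "a \<in> ?T" using Ux(2) r(1) by simp
  qed (rule const)
qed

lemma constant_on_if_differential_zero:
  fixes A :: "('m::{t2_space,second_countable_topology}, 'e::euclidean_space) chart set"
    and B :: "('n::{t2_space,second_countable_topology}, 'd::euclidean_space) chart set"
  assumes A: "smooth_atlas A" and B: "smooth_atlas B" and conn: "connected (UNIV :: 'm set)"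
    and F: "smooth_map A B F"
    and zero: "\<And>p X. X \<in> tangent_space A p \<Longrightarrow> differential B F X = (\<lambda>h. 0)"
  shows "F constant_on UNIV"
proof -
  have "F a = F b" for a b
  proof (rule ccontr)
    assume "F a \<noteq> F b"
    then obtain h where h: "h \<in> smooth_functions B" "h (F a) \<noteq> h (F b)"
      using smooth_functions_separate[OF B] by blast
    have "(h \<circ> F) constant_on UNIV"
    proof (rule smooth_function_constant_on[OF A conn smooth_functions_compose[OF A B F h(1)]])
      fix p X assume "X \<in> tangent_space A p"
      from fun_cong[OF zero[OF this], of h] show "X (h \<circ> F) = 0"
        using h(1) by (simp add: differential_def)
    qed
    then have "(h \<circ> F) a = (h \<circ> F) b" unfolding constant_on_def by (metis UNIV_I)
    then show False using h(2) by simp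
  qed
  then show ?thesis unfolding constant_on_def by blast
qed

section \<open>The golden ratio\<close>

text \<open>For \<open>c = a / b\<close> in lowest terms the equation becomes
  \<open>a^2 = a * b + b^2\<close>, and modulo 2 this is possible only if \<open>a\<close> and
  \<open>b\<close> are both even.\<close>

lemma Rats_not_golden:
  fixes c :: real
  assumes "c \<in> \<rat>"
  shows "c\<^sup>2 \<noteq> c + 1"
proof
  assume eq: "c\<^sup>2 = c + 1"
  from assms obtain a b :: int where ab: "0 < b" "coprime a b" "c = a / b"
    by (elim Rats_cases')
  have "real_of_int (a\<^sup>2) = real_of_int (a * b + b\<^sup>2)"
    using eq ab(1) by (simp add: ab(3) field_simps power2_eq_square)
  then have "a\<^sup>2 = a * b + b\<^sup>2" by linarith
  then have "even (a\<^sup>2) \<longleftrightarrow> even (a * b + b\<^sup>2)" by simp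
  then have "even a" "even b" by auto
  then show False using ab(2) coprime_common_divisor[of a b 2] by simp
qed

section \<open>Vanishing of the differential from the two structure equations\<close>

theorem theorem4p1:
  fixes M1 :: "('m::{t2_space,second_countable_topology}, 'e::euclidean_space) chart set"
    and g1 :: "'m \<Rightarrow> 'm tvec \<Rightarrow> 'm tvec \<Rightarrow> real"
    and J1 :: "'m \<Rightarrow> 'm tvec \<Rightarrow> 'm tvec"
    and M :: "('n::{t2_space,second_countable_topology}, 'd::euclidean_space) chart set"
    and P :: "'n \<Rightarrow> 'n tvec \<Rightarrow> 'n tvec"
    and g :: "'n \<Rightarrow> 'n tvec \<Rightarrow> 'n tvec \<Rightarrow> real"
    and F :: "'m \<Rightarrow> 'n"
    and p q :: nat
    and \<phi> :: real
  assumes "metallic_riemannian_manifold M1 g1 J1 p q"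
    and "connected (UNIV :: 'm set)"
    and "golden_riemannian_manifold M P g"
    and "smooth_map M1 M F"
    and "\<forall>x. \<forall>X\<in>tangent_space M1 x.
           differential M F (J1 x X) = P (F x) (differential M F X)"
    and "\<phi> = (1 + sqrt 5) / 2"
    and "real p \<noteq> real q * \<phi> + (1 - \<phi>)"
    and "real p \<noteq> real q * (1 - \<phi>) + \<phi>"
  shows "F constant_on UNIV"
proof -
  have A: "smooth_atlas M1" and B: "smooth_atlas M"
    using assms(1,3) by (auto simp: metallic_riemannian_manifold_def golden_riemannian_manifold_def
        riemannian_manifold_def)
  \<comment> \<open>For \<open>p = q = 1\<close> the excluded value is the sum of the golden ratio
    and one minus it, which is 1 and hence equals \<open>p\<close>.\<close>
  have "\<not> (p = 1 \<and> q = 1)" using assms(7) by auto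
  show ?thesis
  proof (rule constant_on_if_differential_zero[OF A B assms(2,4)])
    fix x X assume X: "X \<in> tangent_space M1 x"
    define V where "V = differential M F X"
    have JX: "J1 x X \<in> tangent_space M1 x" and JJ: "J1 x (J1 x X) = lincomb (real p) (J1 x X) (real q) X"
      using assms(1) X by (auto simp: metallic_riemannian_manifold_def tensor_field_1_1_def)
    have V: "V \<in> tangent_space M (F x)"
      unfolding V_def by (rule differential_in_tangent_space[OF A B assms(4) X])
    have PV: "P (F x) V \<in> tangent_space M (F x)" "P (F x) (P (F x) V) = lincomb 1 (P (F x) V) 1 V"
      and lin: "\<And>Y Z a b. Y \<in> tangent_space M (F x) \<Longrightarrow> Z \<in> tangent_space M (F x) \<Longrightarrow>
        P (F x) (lincomb a Y b Z) = lincomb a (P (F x) Y) b (P (F x) Z)"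
      using assms(3) V by (auto simp: golden_riemannian_manifold_def tensor_field_1_1_def)
    have "differential M F (J1 x (J1 x X)) = P (F x) (P (F x) V)"
      using assms(5) X JX by (simp add: V_def)
    \<comment> \<open>Linearity of the differential can be read off function by function; on
      functions that are not smooth both sides are 0.\<close>
    moreover have "differential M F (J1 x (J1 x X)) =
        lincomb (real p) (differential M F (J1 x X)) (real q) V"
      by (auto simp: JJ V_def lincomb_def differential_def)
    moreover have "differential M F (J1 x X) = P (F x) V"
      using assms(5) X by (simp add: V_def)
    ultimately have "lincomb 1 (P (F x) V) 1 V = lincomb (real p) (P (F x) V) (real q) V"
      using PV(2) by simp
    then have rel: "(real p - 1) * P (F x) V f + (real q - 1) * V f = 0" for f
      by (auto simp: lincomb_def fun_eq_iff algebra_simps)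
    show "differential M F X = (\<lambda>h. 0)"
    proof (cases "p = 1")
      case True
      \<comment> \<open>Here \<open>q\<close> differs from 1, and the relation reduces to
        \<open>(real q - 1) * V f = 0\<close>.\<close>
      then show ?thesis using rel \<open>\<not> (p = 1 \<and> q = 1)\<close> by (simp add: V_def fun_eq_iff)
    next
      case False
      \<comment> \<open>Solving \<open>rel\<close> for \<open>P (F x) V\<close> gives this factor,
        which is rational because \<open>p\<close> and \<open>q\<close> are natural numbers.\<close>
      define c where "c = - (real q - 1) / (real p - 1)"
      have "P (F x) V f = c * V f" for f
        using rel[of f] False by (simp add: c_def field_simps)
      \<comment> \<open>The multiple of \<open>V\<close> by \<open>c\<close> is written as a
        \<open>lincomb\<close> with a dummy second term, the form in which the linearity of
        \<open>P\<close> is available.\<close>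
      then have cV: "P (F x) V = lincomb c V 0 V"
        by (simp add: lincomb_def fun_eq_iff)
      then have "P (F x) (P (F x) V) = lincomb c (lincomb c V 0 V) 0 (lincomb c V 0 V)"
        using lin[OF V V, of c 0] by simp
      with cV PV(2) have "lincomb 1 (lincomb c V 0 V) 1 V = lincomb c (lincomb c V 0 V) 0 (lincomb c V 0 V)"
        by simp
      \<comment> \<open>The golden equation evaluated on the eigenvector \<open>V\<close>; the
        scalar factor is nonzero for rational \<open>c\<close>, which forces
        \<open>V f = 0\<close>.\<close>
      then have "(c\<^sup>2 - (c + 1)) * V f = 0" for f
        by (auto simp: lincomb_def fun_eq_iff power2_eq_square algebra_simps)
      moreover have "c \<in> \<rat>" by (simp add: c_def)
      then have "c\<^sup>2 \<noteq> c + 1" by (rule Rats_not_golden)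
      ultimately show ?thesis by (simp add: V_def fun_eq_iff)
    qed
  qed
qed

end
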